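(* Let $N\ge 1$, $\tau>0$, let $f:[0,+\infty)\times[0,+\infty)^{2N}\to\mathbb{R}^N$ be continuous, and consider the delay system $x'(t)=f(t,x(t),x(t-\tau))$. Let $V:(0,+\infty)^N\to(0,+\infty)$ be $C^1$ with $\lim_{|x|\to0}V(x)=0$. Assume: (i) if $x,y\in[0,+\infty)^N$ satisfy $x_j=0$ for some $j\in\{1,\dots,N\}$ and $y\neq0$, then $f_j(t,x,y)>0$ for all $t>0$; (ii) there exist $t_0,r_0>0$ such that $\langle\nabla V(x),f(t,x,x)\rangle>0$ for all $t>t_0$ and all $x\in(0,+\infty)^N$ with $V(x)<r_0$; (iii) there exists $\eta>0$ such that $\langle\nabla V(x),f(t,x,y)\rangle\ge\langle\nabla V(x),f(t,x,x)\rangle$ for all $t\ge0$ and all $x,y\in(0,+\infty)^N$ with $V(x)\le V(y)\le\eta$; (iv) there exists $k>0$ such that $\langle\nabla V(x),f(t,x,y)\rangle\ge-kV(x)$ for all $t\ge0$, $x\in(0,+\infty)^N$ and $y\in[0,+\infty)^N$. Then the system is strongly persistent.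
   Context: An initial condition is $x_0=\varphi$ with $\varphi:[-\tau,0]\to[0,+\infty)^N$ continuous, where $x_t(s)=x(t+s)$ for $s\in[-\tau,0]$. It is a standing assumption that the system induces a semi-flow $\Phi(t,\varphi)=x_t$ on $C([-\tau,0],[0,+\infty)^N)$: for each such $\varphi$ the solution exists, is unique, is defined for all $t\ge0$ and stays in $[0,+\infty)^N$. Condition (i) is imposed in order that solutions with initial data $\varphi\not\equiv0$ be strictly positive; it is part of the setting that for each such solution $x(t)\in(0,+\infty)^N$ for all sufficiently large $t$, so that $V(x(t))$ is defined there. The system is strongly persistent if $\liminf_{t\to+\infty}|x(t)|>0$ for every solution with continuous initial condition $\varphi:[-\tau,0]\to[0,+\infty)^N$, $\varphi\not\equiv0$. Here $|\cdot|$ is the Euclidean norm and $\langle\cdot,\cdot\rangle$ the Euclidean inner product. *)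

theory Defs
  imports "HOL-Analysis.Analysis"
begin

definition nonneg_orthant :: "(real ^ 'n) set" where
  "nonneg_orthant = {x. \<forall>i. 0 \<le> x $ i}"

definition pos_orthant :: "(real ^ 'n) set" where
  "pos_orthant = {x. \<forall>i. 0 < x $ i}"

definition initial_condition :: "real \<Rightarrow> (real \<Rightarrow> real ^ 'n) \<Rightarrow> bool" where
  "initial_condition \<tau> \<phi> \<longleftrightarrow>
     continuous_on {-\<tau>..0} \<phi> \<and> (\<forall>s\<in>{-\<tau>..0}. \<phi> s \<in> nonneg_orthant)"

definition nonzero_initial_condition :: "real \<Rightarrow> (real \<Rightarrow> real ^ 'n) \<Rightarrow> bool" where
  "nonzero_initial_condition \<tau> \<phi> \<longleftrightarrow>
     initial_condition \<tau> \<phi> \<and> (\<exists>s\<in>{-\<tau>..0}. \<phi> s \<noteq> 0)"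

text \<open>
  Solutions live on \<open>[-\<tau>, T)\<close> with \<open>0 < T \<le> \<infinity>\<close>. The derivative at \<open>0\<close> is one-sided.
  Values outside the nonnegative orthant are excluded because the right-hand side is only
  meaningful there; \<open>f\<close> and \<open>x\<close> are total functions whose values outside their
  domains play no role.
\<close>

definition dde_solution ::
  "(real \<Rightarrow> real ^ 'n \<Rightarrow> real ^ 'n \<Rightarrow> real ^ 'n) \<Rightarrow> real \<Rightarrow> (real \<Rightarrow> real ^ 'n) \<Rightarrow> ereal
     \<Rightarrow> (real \<Rightarrow> real ^ 'n) \<Rightarrow> bool" where
  "dde_solution f \<tau> \<phi> T x \<longleftrightarrow>
     continuous_on {t. -\<tau> \<le> t \<and> ereal t < T} x \<and>
     (\<forall>t. -\<tau> \<le> t \<and> ereal t < T \<longrightarrow> x t \<in> nonneg_orthant) \<and>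
     (\<forall>s\<in>{-\<tau>..0}. x s = \<phi> s) \<and>
     (\<forall>t. 0 \<le> t \<and> ereal t < T \<longrightarrow>
        (x has_vector_derivative f t (x t) (x (t - \<tau>))) (at t within {s. 0 \<le> s \<and> ereal s < T}))"

text \<open>Global existence in the nonnegative orthant, and uniqueness among local solutions too.\<close>

definition induces_semiflow ::
  "(real \<Rightarrow> real ^ 'n \<Rightarrow> real ^ 'n \<Rightarrow> real ^ 'n) \<Rightarrow> real \<Rightarrow> bool" where
  "induces_semiflow f \<tau> \<longleftrightarrow>
     (\<forall>\<phi>. initial_condition \<tau> \<phi> \<longrightarrow>
        (\<exists>x. dde_solution f \<tau> \<phi> \<infinity> x \<and>
             (\<forall>T y. 0 < T \<and> dde_solution f \<tau> \<phi> T y \<longrightarrow>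
                (\<forall>t. -\<tau> \<le> t \<and> ereal t < T \<longrightarrow> y t = x t))))"

definition eventually_positive_solutions ::
  "(real \<Rightarrow> real ^ 'n \<Rightarrow> real ^ 'n \<Rightarrow> real ^ 'n) \<Rightarrow> real \<Rightarrow> bool" where
  "eventually_positive_solutions f \<tau> \<longleftrightarrow>
     (\<forall>\<phi> x. nonzero_initial_condition \<tau> \<phi> \<and> dde_solution f \<tau> \<phi> \<infinity> x \<longrightarrow>
        (\<forall>\<^sub>F t in at_top. x t \<in> pos_orthant))"

text \<open>The lower limit is taken in \<^typ>\<open>ereal\<close>, since \<open>|x(t)|\<close> may be unbounded.\<close>

definition strongly_persistent ::
  "(real \<Rightarrow> real ^ 'n \<Rightarrow> real ^ 'n \<Rightarrow> real ^ 'n) \<Rightarrow> real \<Rightarrow> bool" where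
  "strongly_persistent f \<tau> \<longleftrightarrow>
     (\<forall>\<phi> x. nonzero_initial_condition \<tau> \<phi> \<and> dde_solution f \<tau> \<phi> \<infinity> x \<longrightarrow>
        Liminf at_top (\<lambda>t. ereal (norm (x t))) > 0)"

end

theory Submission
  imports Defs
begin

text \<open>
  Along a solution \<open>x\<close> that has entered the positive orthant, put \<open>v t = V (x t)\<close>. The proof is a
  Razumikhin argument at a record minimum of \<open>v\<close>. If \<open>v\<close> came close to zero at late times, there
  would be a late time \<open>t\<close> at which \<open>v t\<close> is small and minimal among all values since some fixed
  earlier time, so that \<open>v t \<le> v (t - \<tau>)\<close>. The decay bound (iv) is a differential inequality
  \<open>v' \<ge> - k v\<close>, hence \<open>v (t - \<tau>) \<le> exp (k \<tau>) v t\<close>: the delayed value exceeds the present one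
  by at most a fixed factor, and is therefore still below \<open>\<eta>\<close>. This is the regime in which (iii)
  replaces the delayed argument by the present one, and (ii) then gives \<open>v' t > 0\<close>. But \<open>v\<close> cannot
  be strictly increasing at a point where it attains its minimum over the past.

  Lemma \<open>razumikhin_lower_bound\<close> is this argument for a scalar function. Its conclusion, that \<open>v\<close> stays
  away from zero, yields persistence because \<open>V\<close> tends to zero at the origin: small values of
  \<open>norm (x t)\<close> would force small values of \<open>v t\<close>.
\<close>

text \<open>The function \<open>exp (k * t) * v t\<close> is nondecreasing.\<close>

lemma exp_growth_backwards:
  fixes v v' :: "real \<Rightarrow> real"
  assumes "a \<le> b"
    and deriv: "\<And>t. a \<le> t \<Longrightarrow> t \<le> b \<Longrightarrow> (v has_real_derivative v' t) (at t)"
    and lower: "\<And>t. a \<le> t \<Longrightarrow> t \<le> b \<Longrightarrow> - k * v t \<le> v' t"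
  shows "v a \<le> exp (k * (b - a)) * v b"
proof -
  have "exp (k * a) * v a \<le> exp (k * b) * v b"
  proof (rule DERIV_nonneg_imp_nondecreasing[OF \<open>a \<le> b\<close>, where f = "\<lambda>t. exp (k * t) * v t"])
    fix t assume t: "a \<le> t" "t \<le> b"
    have "((\<lambda>t. exp (k * t) * v t) has_real_derivative exp (k * t) * (v' t + k * v t)) (at t)"
      by (auto intro!: derivative_eq_intros deriv t simp: algebra_simps)
    moreover have "0 \<le> exp (k * t) * (v' t + k * v t)"
      using lower[OF t] by simp
    ultimately show "\<exists>y. ((\<lambda>t. exp (k * t) * v t) has_real_derivative y) (at t) \<and> 0 \<le> y"
      by blast
  qed
  then have "v a \<le> exp (k * b) * v b / exp (k * a)"
    by (simp add: pos_le_divide_eq mult.commute)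
  then show ?thesis
    by (simp add: right_diff_distrib exp_diff)
qed

text \<open>
  A sufficiently small record minimum of \<open>v\<close> occurs more than one delay after \<open>T\<close>, satisfies the
  comparison \<open>v t \<le> v (t - \<tau>)\<close> by minimality, and satisfies \<open>v (t - \<tau>) \<le> \<eta>\<close> because \<open>v\<close> decays
  at most exponentially. It would thus be a point of strict increase, which is absurd.
\<close>

lemma razumikhin_lower_bound:
  fixes v v' :: "real \<Rightarrow> real"
  assumes "0 < \<tau>" "0 < r" "0 < \<eta>"
    and pos: "\<And>t. T \<le> t \<Longrightarrow> 0 < v t"
    and deriv: "\<And>t. T \<le> t \<Longrightarrow> (v has_real_derivative v' t) (at t)"
    and lower: "\<And>t. T \<le> t \<Longrightarrow> - k * v t \<le> v' t"
    and incr: "\<And>t. T + \<tau> \<le> t \<Longrightarrow> v t < r \<Longrightarrow> v t \<le> v (t - \<tau>) \<Longrightarrow> v (t - \<tau>) \<le> \<eta> \<Longrightarrow> 0 < v' t"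
  shows "\<exists>\<delta>>0. \<forall>t\<ge>T. \<delta> \<le> v t"
proof -
  have cont: "continuous_on {T..b} v" for b
    by (intro DERIV_continuous_on[where D = v'] DERIV_subset[OF deriv]) auto
  obtain p where p: "p \<in> {T..T+\<tau>}" and p_min: "\<And>t. t \<in> {T..T+\<tau>} \<Longrightarrow> v p \<le> v t"
    using continuous_attains_inf[OF compact_Icc _ cont[of "T + \<tau>"]] \<open>0 < \<tau>\<close> by auto
  (* Below v p a minimum over the past cannot lie in the first delay interval; the factor
     exp (- k \<tau>) pays for the possible decay of v between t - \<tau> and t. *)
  define \<delta> where "\<delta> = min (v p) (min r (exp (- (k * \<tau>)) * \<eta>))"
  have "0 < \<delta>"
    using assms(2,3) pos[of p] p by (simp add: \<delta>_def)
  moreover have "\<delta> \<le> v s" if "T \<le> s" for s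
  proof (rule ccontr)
    assume "\<not> \<delta> \<le> v s"
    obtain t where t: "t \<in> {T..s}" and t_min: "\<And>u. u \<in> {T..s} \<Longrightarrow> v t \<le> v u"
      using continuous_attains_inf[OF compact_Icc _ cont[of s]] \<open>T \<le> s\<close> by auto
    have small: "v t < \<delta>"
      using t_min[of s] \<open>T \<le> s\<close> \<open>\<not> \<delta> \<le> v s\<close> by simp
    have late: "T + \<tau> < t"
      using small p_min[of t] t by (force simp: \<delta>_def)
    have "v (t - \<tau>) \<le> exp (k * \<tau>) * v t"
      using exp_growth_backwards[of "t - \<tau>" t v v' k] deriv lower late \<open>0 < \<tau>\<close> by simp
    also have "\<dots> \<le> exp (k * \<tau>) * (exp (- (k * \<tau>)) * \<eta>)"
      using small by (intro mult_left_mono) (auto simp: \<delta>_def)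
    also have "\<dots> = \<eta>"
      by (simp flip: mult.assoc exp_add)
    finally have "0 < v' t"
      using incr[of t] small late t t_min[of "t - \<tau>"] \<open>0 < \<tau>\<close> by (simp add: \<delta>_def)
    then obtain d where d: "0 < d" "\<And>h. 0 < h \<Longrightarrow> h < d \<Longrightarrow> v (t - h) < v t"
      using DERIV_pos_inc_left[OF deriv[of t]] t by auto
    (* A point just before t at which v is smaller still lies in the range where t is minimal. *)
  define h where "h = min (d / 2) \<tau>"
    have "v (t - h) < v t"
      using d \<open>0 < \<tau>\<close> by (simp add: h_def min_def)
    moreover have "t - h \<in> {T..s}"
      using late t \<open>0 < d\<close> \<open>0 < \<tau>\<close> by (auto simp: h_def min_def)
    ultimately show False
      using t_min[of "t - h"] by simp
  qed
  ultimately show ?thesis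
    by blast
qed

lemma dde_solution_infinity_derivative:
  assumes "dde_solution f \<tau> \<phi> \<infinity> x" "0 < t"
  shows "(x has_vector_derivative f t (x t) (x (t - \<tau>))) (at t)"
proof -
  have "(x has_vector_derivative f t (x t) (x (t - \<tau>))) (at t within {s. 0 \<le> s \<and> ereal s < \<infinity>})"
    using assms unfolding dde_solution_def by simp
  moreover have "{s. 0 \<le> s \<and> ereal s < \<infinity>} = {0..}"
    by auto
  moreover have "at t within {0..} = at t"
    using \<open>0 < t\<close> by (intro at_within_interior) simp
  ultimately show ?thesis
    by simp
qed

lemma GDERIV_chain_has_real_derivative:
  assumes "GDERIV V (x t) :> g" "(x has_vector_derivative y) (at t)"
  shows "((\<lambda>t. V (x t)) has_real_derivative g \<bullet> y) (at t)"
proof -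
  have "(V \<circ> x has_derivative (\<lambda>h. h \<bullet> g) \<circ> (\<lambda>h. h *\<^sub>R y)) (at t)"
    using assms unfolding gderiv_def has_vector_derivative_def
    by (intro diff_chain_at) auto
  then show ?thesis
    by (simp add: has_field_derivative_def o_def inner_commute mult_commute_abs)
qed

theorem proposition3:
  fixes f :: "real \<Rightarrow> real ^ 'n \<Rightarrow> real ^ 'n \<Rightarrow> real ^ 'n"
    and V :: "real ^ 'n \<Rightarrow> real"
    and gradV :: "real ^ 'n \<Rightarrow> real ^ 'n"
    and \<tau> :: real
  assumes tau_pos: "\<tau> > 0"
    and f_cont: "continuous_on ({0..} \<times> nonneg_orthant \<times> nonneg_orthant) (\<lambda>(t, x, y). f t x y)"
    and semiflow: "induces_semiflow f \<tau>"
    and positivity: "eventually_positive_solutions f \<tau>"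
    and V_pos: "\<forall>x\<in>pos_orthant. V x > 0"
    and V_grad: "\<forall>x\<in>pos_orthant. GDERIV V x :> gradV x"
    and V_C1: "continuous_on pos_orthant gradV"
    and V_lim: "(V \<longlongrightarrow> 0) (at 0 within pos_orthant)"
    and i: "\<forall>x\<in>nonneg_orthant. \<forall>y\<in>nonneg_orthant. \<forall>j.
              x $ j = 0 \<and> y \<noteq> 0 \<longrightarrow> (\<forall>t>0. f t x y $ j > 0)"
    and ii: "\<exists>t0>0. \<exists>r0>0. \<forall>t>t0. \<forall>x\<in>pos_orthant.
               V x < r0 \<longrightarrow> gradV x \<bullet> f t x x > 0"
    and iii: "\<exists>\<eta>>0. \<forall>t\<ge>0. \<forall>x\<in>pos_orthant. \<forall>y\<in>pos_orthant.
                V x \<le> V y \<and> V y \<le> \<eta> \<longrightarrow> gradV x \<bullet> f t x y \<ge> gradV x \<bullet> f t x x"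
    and iv: "\<exists>k>0. \<forall>t\<ge>0. \<forall>x\<in>pos_orthant. \<forall>y\<in>nonneg_orthant.
               gradV x \<bullet> f t x y \<ge> - k * V x"
  shows "strongly_persistent f \<tau>"
  unfolding strongly_persistent_def
proof (intro allI impI, elim conjE)
  fix \<phi> x
  assume nonzero: "nonzero_initial_condition \<tau> \<phi>" and sol: "dde_solution f \<tau> \<phi> \<infinity> x"
  obtain t0 r0 where "r0 > 0"
    and ii': "\<And>t z. t > t0 \<Longrightarrow> z \<in> pos_orthant \<Longrightarrow> V z < r0 \<Longrightarrow> gradV z \<bullet> f t z z > 0"
    using ii by blast
  obtain \<eta> where "\<eta> > 0"
    and iii': "\<And>t z y. t \<ge> 0 \<Longrightarrow> z \<in> pos_orthant \<Longrightarrow> y \<in> pos_orthant \<Longrightarrow> V z \<le> V y \<Longrightarrow> V y \<le> \<eta> \<Longrightarrow>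
                 gradV z \<bullet> f t z y \<ge> gradV z \<bullet> f t z z"
    using iii by blast
  obtain k where iv': "\<And>t z y. t \<ge> 0 \<Longrightarrow> z \<in> pos_orthant \<Longrightarrow> y \<in> nonneg_orthant \<Longrightarrow>
                         gradV z \<bullet> f t z y \<ge> - k * V z"
    using iv by blast
  obtain T1 where T1: "\<And>t. T1 \<le> t \<Longrightarrow> x t \<in> pos_orthant"
    using positivity nonzero sol
    unfolding eventually_positive_solutions_def eventually_at_top_linorder by blast
  (* The bound 1 keeps t > 0, so that the solution has a two-sided derivative. *)
  define T where "T = max T1 (max 1 t0)"
  have T: "x t \<in> pos_orthant" "0 < t" "t0 \<le> t" if "T \<le> t" for t
    using that T1 by (auto simp: T_def)
  have nonneg: "x t \<in> nonneg_orthant" if "- \<tau> \<le> t" for t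
    using sol that unfolding dde_solution_def by simp
  define v' where "v' t = gradV (x t) \<bullet> f t (x t) (x (t - \<tau>))" for t
  have "\<exists>\<delta>>0. \<forall>t\<ge>T. \<delta> \<le> V (x t)"
  proof (rule razumikhin_lower_bound[OF tau_pos \<open>r0 > 0\<close> \<open>\<eta> > 0\<close>,
        where v = "\<lambda>t. V (x t)" and v' = v' and T = T and k = k])
    fix t assume t: "T \<le> t"
    show "0 < V (x t)"
      using V_pos T(1)[OF t] by blast
    show "((\<lambda>t. V (x t)) has_real_derivative v' t) (at t)"
      unfolding v'_def using V_grad T[OF t] dde_solution_infinity_derivative[OF sol]
      by (intro GDERIV_chain_has_real_derivative) auto
    show "- k * V (x t) \<le> v' t"
      unfolding v'_def using T[OF t] by (intro iv' nonneg) auto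
  next
    fix t assume t: "T + \<tau> \<le> t" "V (x t) < r0" "V (x t) \<le> V (x (t - \<tau>))" "V (x (t - \<tau>)) \<le> \<eta>"
    have "T \<le> t - \<tau>" "T \<le> t" "t0 < t"
      using t(1) tau_pos T(3)[of "t - \<tau>"] by auto
    then have "0 < gradV (x t) \<bullet> f t (x t) (x t)"
      using ii' T t(2) by blast
    also have "\<dots> \<le> v' t"
      unfolding v'_def using t T \<open>T \<le> t - \<tau>\<close> \<open>T \<le> t\<close> by (intro iii') (auto intro: less_imp_le)
    finally show "0 < v' t" .
  qed
  then obtain \<delta> where "0 < \<delta>" and \<delta>: "\<And>t. T \<le> t \<Longrightarrow> \<delta> \<le> V (x t)"
    by blast
  obtain d where "0 < d"
    and d: "\<And>z. z \<in> pos_orthant \<Longrightarrow> z \<noteq> 0 \<Longrightarrow> dist z 0 < d \<Longrightarrow> dist (V z) 0 < \<delta>"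
    using tendstoD[OF V_lim \<open>0 < \<delta>\<close>] unfolding eventually_at by blast
  have far: "d \<le> norm (x t)" if "T \<le> t" for t
  proof (rule ccontr)
    assume "\<not> d \<le> norm (x t)"
    moreover have "x t \<noteq> 0"
      using T(1)[OF that] by (auto simp: pos_orthant_def)
    ultimately have "\<bar>V (x t)\<bar> < \<delta>"
      using d[of "x t"] T(1)[OF that] by simp
    then show False
      using \<delta>[OF that] by simp
  qed
  have "0 < ereal d"
    using \<open>0 < d\<close> by simp
  also have "\<dots> \<le> Liminf at_top (\<lambda>t. ereal (norm (x t)))"
    using far by (intro Liminf_bounded) (auto simp: eventually_at_top_linorder)
  finally show "0 < Liminf at_top (\<lambda>t. ereal (norm (x t)))" .
qed

end
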